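(* Let $\mathcal{A}$ be a unital complex Banach algebra and let $a,b\in\mathcal{A}^d$ be $\{a,b\}$-weakly commutative. Then the following are equivalent: (i) $a+b\in\mathcal{A}^d$; (ii) $aa^d(a+b)bb^d\in\mathcal{A}^d$; (iii) $aa^d(a+b)\in\mathcal{A}^d$; (iv) $(a+b)bb^d\in\mathcal{A}^d$.
   Context: An element $x$ of the unital complex Banach algebra $\mathcal{A}$ is quasinilpotent if $\lim_{n\to\infty}\|x^n\|^{1/n}=0$; $\mathcal{A}^{qnil}$ is the set of quasinilpotent elements. An element $a\in\mathcal{A}$ is g-Drazin invertible if there is $a^d\in\mathcal{A}$ (the g-Drazin inverse of $a$, unique when it exists) with $aa^d=a^da$, $a^daa^d=a^d$ and $a-a^2a^d\in\mathcal{A}^{qnil}$; $\mathcal{A}^d$ is the set of g-Drazin invertible elements. Elements $a,b\in\mathcal{A}$ are $a$-weakly commutative if there is $c_1\in\mathcal{A}$ with $ab=c_1a$ and $ba=ac_1$; they are $b$-weakly commutative if there is $c_2\in\mathcal{A}$ with $ab=bc_2$ and $ba=c_2b$; they are $\{a,b\}$-weakly commutative if they are both $a$-weakly commutative and $b$-weakly commutative. *)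

theory Defs
  imports "HOL-Analysis.Analysis"
begin

text \<open>
  HOL-Analysis only provides real Banach algebras (\<open>real_normed_algebra_1\<close> together with
  \<open>banach\<close>). A complex scalar multiplication is added which extends the real one, is compatible
  with the product and for which the norm is a complex algebra norm. The norm is submultiplicative
  with \<open>norm 1 = 1\<close>; the multiplication need not be commutative.
\<close>

class complex_banach_algebra_1 = real_normed_algebra_1 + banach +
  fixes scaleC :: "complex \<Rightarrow> 'a \<Rightarrow> 'a"
  assumes scaleC_of_real: "scaleC (of_real r) x = scaleR r x"
    and scaleC_add_right: "scaleC z (x + y) = scaleC z x + scaleC z y"
    and scaleC_add_left: "scaleC (z + w) x = scaleC z x + scaleC w x"
    and scaleC_scaleC: "scaleC z (scaleC w x) = scaleC (z * w) x"
    and scaleC_one: "scaleC 1 x = x"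
    and mult_scaleC_left: "scaleC z x * y = scaleC z (x * y)"
    and mult_scaleC_right: "x * scaleC z y = scaleC z (x * y)"
    and norm_scaleC: "norm (scaleC z x) = cmod z * norm x"

instantiation complex :: complex_banach_algebra_1
begin

definition scaleC_complex :: "complex \<Rightarrow> complex \<Rightarrow> complex"
  where "scaleC_complex z x = z * x"

instance
  by standard (auto simp: scaleC_complex_def algebra_simps scaleR_conv_of_real norm_mult)

end

definition quasinilpotent :: "'a::complex_banach_algebra_1 \<Rightarrow> bool"
  where "quasinilpotent x \<longleftrightarrow> (\<lambda>n. root n (norm (x ^ n))) \<longlonglongrightarrow> 0"

definition is_gdrazin_inverse :: "'a::complex_banach_algebra_1 \<Rightarrow> 'a \<Rightarrow> bool"
  where "is_gdrazin_inverse a d \<longleftrightarrow>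
    a * d = d * a \<and> d * a * d = d \<and> quasinilpotent (a - a\<^sup>2 * d)"

definition gdrazin_invertible :: "'a::complex_banach_algebra_1 \<Rightarrow> bool"
  where "gdrazin_invertible a \<longleftrightarrow> (\<exists>d. is_gdrazin_inverse a d)"

definition gdrazin_inverse :: "'a::complex_banach_algebra_1 \<Rightarrow> 'a"
  where "gdrazin_inverse a = (THE d. is_gdrazin_inverse a d)"

definition left_weakly_commutative :: "'a::complex_banach_algebra_1 \<Rightarrow> 'a \<Rightarrow> bool"
  where "left_weakly_commutative a b \<longleftrightarrow> (\<exists>c. a * b = c * a \<and> b * a = a * c)"

definition right_weakly_commutative :: "'a::complex_banach_algebra_1 \<Rightarrow> 'a \<Rightarrow> bool"
  where "right_weakly_commutative a b \<longleftrightarrow> (\<exists>c. a * b = b * c \<and> b * a = c * b)"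

text \<open>
  With respect to the pair \<open>a, b\<close>, the notion \<open>left_weakly_commutative\<close> is \<open>a\<close>-weak commutativity,
  \<open>right_weakly_commutative\<close> is \<open>b\<close>-weak commutativity, and the following is
  \<open>{a, b}\<close>-weak commutativity; the witnesses of the two parts may differ.
\<close>

definition weakly_commutative :: "'a::complex_banach_algebra_1 \<Rightarrow> 'a \<Rightarrow> bool"
  where "weakly_commutative a b \<longleftrightarrow>
    left_weakly_commutative a b \<and> right_weakly_commutative a b"

text \<open>
  Uniqueness of the g-Drazin inverse, so that the definite description in \<open>gdrazin_inverse\<close>
  denotes the inverse whenever one exists.
\<close>

lemma quasinilpotent_power_tendsto:
  fixes x :: "'a::complex_banach_algebra_1" and K :: real
  assumes "quasinilpotent x" "K \<ge> 0"
  shows "(\<lambda>n. K ^ n * norm (x ^ n)) \<longlonglongrightarrow> 0"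
proof -
  have "(\<lambda>n. K * root n (norm (x ^ n))) \<longlonglongrightarrow> K * 0"
    using assms(1) unfolding quasinilpotent_def by (rule tendsto_mult_left)
  then have "eventually (\<lambda>n. K * root n (norm (x ^ n)) < 1/2) sequentially"
    by (rule order_tendstoD) simp
  then have ev: "eventually (\<lambda>n. K ^ n * norm (x ^ n) \<le> (1/2) ^ n) sequentially"
    using eventually_gt_at_top[of 0]
  proof eventually_elim
    case (elim n)
    have "(K * root n (norm (x ^ n))) ^ n \<le> (1/2) ^ n"
      using elim assms(2) by (intro power_mono) auto
    then show ?case
      using elim by (simp add: power_mult_distrib real_root_pow_pos2)
  qed
  show ?thesis
    by (rule tendsto_sandwich[OF _ ev tendsto_const LIMSEQ_realpow_zero])
      (use assms(2) in auto)
qed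

lemma gdrazin_projection_absorb:
  fixes a b c :: "'a::complex_banach_algebra_1"
  assumes b: "is_gdrazin_inverse a b" and c: "is_gdrazin_inverse a c"
  shows "a * b * (1 - a * c) = 0" "(1 - a * c) * (a * b) = 0"
proof -
  have ab: "a * b = b * a" and bab: "b * a * b = b"
    and ac: "a * c = c * a" and cac: "c * a * c = c"
    and q: "quasinilpotent (a - a\<^sup>2 * c)"
    using b c by (auto simp: is_gdrazin_inverse_def)
  define p where "p = 1 - a * c"
  have pa: "p * a = a * p"
    by (simp add: p_def algebra_simps) (metis ac mult.assoc)
  have pp: "p * p = p"
    by (simp add: p_def algebra_simps) (metis cac mult.assoc)
  have ap: "a - a\<^sup>2 * c = a * p"
    by (simp add: p_def algebra_simps power2_eq_square)
  have pan: "p * a ^ n = a ^ n * p" for n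
    by (induction n) (simp_all, metis pa mult.assoc)
  have apn: "(a * p) ^ n * p = a ^ n * p" for n
  proof (induction n)
    case (Suc n)
    have "(a * p) ^ Suc n * p = a * p * (a ^ n * p)"
      by (simp add: mult.assoc Suc.IH)
    also have "\<dots> = a * a ^ n * (p * p)"
      by (metis pan mult.assoc)
    finally show ?case by (simp add: pp)
  qed simp
  have ban: "b ^ n * a ^ n = a ^ n * b ^ n" for n
    using ab by (metis power_commuting_commutes)
  have abn: "b ^ Suc n * a ^ Suc n = a * b" for n
  proof (induction n)
    case (Suc n)
    have "b ^ Suc (Suc n) * a ^ Suc (Suc n) = b * (b ^ Suc n * a ^ Suc n) * a"
      by (metis power_Suc power_Suc2 mult.assoc)
    also have "\<dots> = b * (a * b) * a" by (simp only: Suc.IH)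
    also have "\<dots> = a * b" by (metis ab bab mult.assoc)
    finally show ?case .
  qed (simp add: ab)
  have lim: "(\<lambda>n. norm b ^ Suc n * norm ((a * p) ^ Suc n) * norm p) \<longlonglongrightarrow> 0"
    using tendsto_mult_right[OF LIMSEQ_Suc[OF quasinilpotent_power_tendsto[OF q, of "norm b"]],
        of "norm p"] by (simp add: ap)
  have le1: "norm (a * b * p) \<le> norm b ^ Suc n * norm ((a * p) ^ Suc n) * norm p" for n
  proof -
    have "a * b * p = b ^ Suc n * ((a * p) ^ Suc n * p)"
      by (simp only: abn[of n, symmetric] apn mult.assoc)
    also have "norm \<dots> \<le> norm (b ^ Suc n) * norm ((a * p) ^ Suc n * p)"
      by (rule norm_mult_ineq)
    also have "\<dots> \<le> norm b ^ Suc n * (norm ((a * p) ^ Suc n) * norm p)"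
      by (intro mult_mono norm_power_ineq norm_mult_ineq) auto
    finally show ?thesis by (simp only: mult.assoc)
  qed
  have le2: "norm (p * (a * b)) \<le> norm b ^ Suc n * norm ((a * p) ^ Suc n) * norm p" for n
  proof -
    have "p * (a * b) = ((a * p) ^ Suc n * p) * b ^ Suc n"
      by (metis abn apn ban pan mult.assoc)
    also have "norm \<dots> \<le> norm ((a * p) ^ Suc n * p) * norm (b ^ Suc n)"
      by (rule norm_mult_ineq)
    also have "\<dots> \<le> (norm ((a * p) ^ Suc n) * norm p) * norm b ^ Suc n"
      by (intro mult_mono norm_power_ineq norm_mult_ineq) auto
    finally show ?thesis by (simp only: mult_ac)
  qed
  have "norm (a * b * p) \<le> 0"
    by (rule LIMSEQ_le_const[OF lim]) (use le1 in blast)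
  moreover have "norm (p * (a * b)) \<le> 0"
    by (rule LIMSEQ_le_const[OF lim]) (use le2 in blast)
  ultimately show "a * b * (1 - a * c) = 0" "(1 - a * c) * (a * b) = 0"
    by (simp_all add: p_def)
qed

lemma is_gdrazin_inverse_unique:
  fixes a b c :: "'a::complex_banach_algebra_1"
  assumes b: "is_gdrazin_inverse a b" and c: "is_gdrazin_inverse a c"
  shows "b = c"
proof -
  have ab: "a * b = b * a" and bab: "b * a * b = b"
    and ac: "a * c = c * a" and cac: "c * a * c = c"
    using b c by (auto simp: is_gdrazin_inverse_def)
  have "a * b = a * b * (a * c)"
    using gdrazin_projection_absorb(1)[OF b c] by (simp add: right_diff_distrib)
  moreover have "a * c = a * b * (a * c)"
    using gdrazin_projection_absorb(2)[OF c b] by (simp add: left_diff_distrib)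
  ultimately have "a * b = a * c" by simp
  then show ?thesis by (metis ab ac bab cac mult.assoc)
qed

lemma is_gdrazin_inverse_gdrazin_inverse:
  assumes "gdrazin_invertible a"
  shows "is_gdrazin_inverse a (gdrazin_inverse a)"
  using assms unfolding gdrazin_invertible_def gdrazin_inverse_def
  by (metis theI is_gdrazin_inverse_unique)

end

theory Submission
  imports Defs
begin

text \<open>
  Write \<open>p = a a\<^sup>d\<close> and \<open>q = b b\<^sup>d\<close>. The whole argument rests on one observation: from
  \<open>a b = c a\<close> and \<open>b a = a c\<close> it follows that \<open>a\<^sup>2 b = a c a = b a\<^sup>2\<close>, and symmetrically \<open>b\<^sup>2\<close>
  commutes with \<open>a\<close>. Since \<open>p = a\<^sup>2 (a\<^sup>d)\<^sup>2\<close> is also the idempotent belonging to \<open>a\<^sup>2\<close>, it commutes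
  with everything that commutes with \<open>a\<^sup>2\<close> (\<open>gdrazin_commute_of_square_commute\<close>). So \<open>p\<close> and \<open>q\<close>
  commute with \<open>a\<close>, \<open>b\<close> and each other, although \<open>a\<close> and \<open>b\<close> do not commute.

  An idempotent commuting with \<open>x\<close> splits the question whether \<open>x\<close> is g-Drazin invertible into the
  same question for its two compressions (\<open>gdrazin_invertible_split_iff\<close>). Each of the stated
  equivalences therefore reduces to the claim that \<open>(1 - p) (a + b)\<close>, and by symmetry
  \<open>(1 - q) (a + b)\<close>, is always g-Drazin invertible (\<open>gdrazin_invertible_complement_add\<close>). As
  \<open>(1 - p) a\<close> is quasinilpotent, this is the case of a quasinilpotent \<open>a\<close>
  (\<open>gdrazin_invertible_quasinilpotent_add\<close>), which is split once more, by \<open>q\<close>: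
  \<^item> under \<open>1 - q\<close> both summands are quasinilpotent, and so is their sum
    (\<open>quasinilpotent_add_weakly_commutative\<close>);
  \<^item> under \<open>q\<close> the element \<open>b\<close> is invertible with inverse \<open>b\<^sup>d\<close>, and \<open>b + a = b (1 + b\<^sup>d a)\<close> is
    invertible because \<open>b\<^sup>d a\<close> is quasinilpotent (\<open>quasinilpotent_gdrazin_inverse_mult\<close>).

  Both quasinilpotency facts are proved by squaring, in the case of the sum twice: after splitting
  off commuting quasinilpotent terms, the outcome is a multiple of \<open>a\<^sup>2\<close> by an element that commutes
  with \<open>a\<^sup>2\<close>.
\<close>

section \<open>Quasinilpotent elements\<close>

text \<open>
  Bounds by every geometric sequence are easier to combine than limits of roots: products and sums of
  commuting elements are then estimated power by power.
\<close>

lemma quasinilpotent_iff_geometric: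
  fixes x :: "'a::complex_banach_algebra_1"
  shows "quasinilpotent x \<longleftrightarrow> (\<forall>e>0. \<exists>C>0. \<forall>n. norm (x ^ n) \<le> C * e ^ n)"
proof (intro iffI allI impI)
  fix e :: real
  assume qn: "quasinilpotent x" and e: "e > 0"
  have "(\<lambda>n. (1 / e) ^ n * norm (x ^ n)) \<longlonglongrightarrow> 0"
    using qn e by (intro quasinilpotent_power_tendsto) auto
  then have "Bseq (\<lambda>n. (1 / e) ^ n * norm (x ^ n))"
    by (meson convergentI convergent_imp_Bseq)
  then obtain C where C: "C > 0" "\<And>n. norm ((1 / e) ^ n * norm (x ^ n)) \<le> C"
    by (auto elim: BseqE)
  have "norm (x ^ n) \<le> C * e ^ n" for n
    using C(2)[of n] e by (simp add: power_divide field_simps)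
  with C(1) show "\<exists>C>0. \<forall>n. norm (x ^ n) \<le> C * e ^ n" by blast
next
  assume geo: "\<forall>e>0. \<exists>C>0. \<forall>n. norm (x ^ n) \<le> C * e ^ n"
  show "quasinilpotent x"
    unfolding quasinilpotent_def
  proof (rule order_tendstoI)
    fix y :: real
    assume "y < 0"
    then show "\<forall>\<^sub>F n in sequentially. y < root n (norm (x ^ n))"
      by (intro always_eventually allI) (meson less_le_trans norm_ge_zero real_root_ge_zero)
  next
    fix y :: real
    assume y: "0 < y"
    then obtain C where C: "C > 0" "\<And>n. norm (x ^ n) \<le> C * (y / 2) ^ n"
      using geo by (meson half_gt_zero)
    have "\<forall>\<^sub>F n in sequentially. root n C < 2"
      using LIMSEQ_root_const[OF C(1)] by (rule order_tendstoD) simp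
    then show "\<forall>\<^sub>F n in sequentially. root n (norm (x ^ n)) < y"
      using eventually_gt_at_top[of 0]
    proof eventually_elim
      case (elim n)
      have "root n (norm (x ^ n)) \<le> root n (C * (y / 2) ^ n)"
        using C(2) elim by simp
      also have "\<dots> = root n C * (y / 2)"
        using elim y by (simp add: real_root_mult real_root_power_cancel)
      also have "\<dots> < 2 * (y / 2)"
        using elim y by (intro mult_strict_right_mono) auto
      finally show ?case by simp
    qed
  qed
qed

lemma quasinilpotent_zero: "quasinilpotent (0 :: 'a::complex_banach_algebra_1)"
  unfolding quasinilpotent_iff_geometric by (intro allI impI exI[of _ "1 :: real"]) (simp add: power_0_left)

lemma commute_mult:
  fixes x y z :: "'a::semigroup_mult"
  assumes "z * x = x * z" and "z * y = y * z"
  shows "z * (x * y) = x * y * z"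
  using assms by (metis mult.assoc)

lemma power_mult_commuting:
  fixes x y :: "'a::monoid_mult"
  assumes "x * y = y * x"
  shows "(x * y) ^ n = x ^ n * y ^ n"
proof (induction n)
  case (Suc n)
  have "x * y * (x ^ n * y ^ n) = x * (y * x ^ n) * y ^ n"
    by (simp add: mult.assoc)
  also have "\<dots> = x * (x ^ n * y) * y ^ n"
    using assms by (metis power_commuting_commutes)
  finally show ?case
    by (simp add: Suc.IH mult.assoc)
qed simp

lemma quasinilpotent_mult_commuting:
  fixes x y :: "'a::complex_banach_algebra_1"
  assumes x: "quasinilpotent x" and xy: "x * y = y * x"
  shows "quasinilpotent (x * y)"
  unfolding quasinilpotent_iff_geometric
proof (intro allI impI)
  fix e :: real
  assume e: "e > 0"
  define K where "K = norm y + 1"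
  have K: "K > 0" "norm y \<le> K"
    by (auto simp: K_def add_nonneg_pos)
  then have "e / K > 0"
    using e by simp
  then obtain C where C: "C > 0" "\<And>n. norm (x ^ n) \<le> C * (e / K) ^ n"
    using x unfolding quasinilpotent_iff_geometric by meson
  have "norm ((x * y) ^ n) \<le> C * e ^ n" for n
  proof -
    have "norm ((x * y) ^ n) \<le> norm (x ^ n) * norm (y ^ n)"
      by (simp add: power_mult_commuting[OF xy] norm_mult_ineq)
    also have "\<dots> \<le> (C * (e / K) ^ n) * K ^ n"
    proof (intro mult_mono C(2))
      show "norm (y ^ n) \<le> K ^ n"
        using K by (meson norm_ge_zero norm_power_ineq order_trans power_mono)
    qed (use C K e in auto)
    finally show ?thesis
      using K by (simp add: power_divide)
  qed
  with C(1) show "\<exists>C>0. \<forall>n. norm ((x * y) ^ n) \<le> C * e ^ n" by blast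
qed

text \<open>
  This equivalence lets quasinilpotency be tested on squares, where weak commutativity turns into
  honest commutativity. For the nontrivial direction, an odd power costs one factor \<open>x\<close>, which the
  constant absorbs.
\<close>

lemma quasinilpotent_square_iff:
  fixes x :: "'a::complex_banach_algebra_1"
  shows "quasinilpotent (x\<^sup>2) \<longleftrightarrow> quasinilpotent x"
proof
  assume "quasinilpotent x"
  then show "quasinilpotent (x\<^sup>2)"
    unfolding power2_eq_square by (rule quasinilpotent_mult_commuting) simp
next
  assume sq: "quasinilpotent (x\<^sup>2)"
  show "quasinilpotent x"
    unfolding quasinilpotent_iff_geometric
  proof (intro allI impI)
    fix e :: real
    assume e: "e > 0"
    then have "e\<^sup>2 > 0" by simp
    then obtain C where C: "C > 0" "\<And>n. norm ((x\<^sup>2) ^ n) \<le> C * (e\<^sup>2) ^ n"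
      using sq unfolding quasinilpotent_iff_geometric by meson
    define D where "D = C * (1 + norm x / e)"
    have D: "D > 0" "C \<le> D" "C * norm x \<le> D * e"
      using C(1) e by (auto simp: D_def field_simps add_pos_nonneg)
    have "norm (x ^ n) \<le> D * e ^ n" for n
    proof (cases "even n")
      case True
      then obtain k where n: "n = 2 * k" by blast
      have "norm (x ^ n) \<le> C * e ^ n"
        using C(2)[of k] by (simp add: n power_mult)
      also have "\<dots> \<le> D * e ^ n"
        using D e by (intro mult_right_mono) auto
      finally show ?thesis .
    next
      case False
      then obtain k where n: "n = Suc (2 * k)" by (auto elim: oddE)
      have "norm (x ^ n) \<le> norm x * norm (x ^ (2 * k))"
        by (simp add: n norm_mult_ineq)
      also have "\<dots> \<le> norm x * (C * e ^ (2 * k))"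
        using C(2)[of k] by (intro mult_left_mono) (auto simp: power_mult)
      also have "\<dots> \<le> (D * e) * e ^ (2 * k)"
        using D e by (simp add: mult.assoc[symmetric] mult.commute[of "norm x"])
      finally show ?thesis
        by (simp add: n mult.assoc)
    qed
    with D(1) show "\<exists>C>0. \<forall>n. norm (x ^ n) \<le> C * e ^ n" by blast
  qed
qed

text \<open>
  Strengthening the claim by a trailing factor \<open>x\<^sup>i y\<^sup>j\<close> allows an induction on \<open>n\<close> that takes the
  place of the binomial theorem: each step turns one factor \<open>x + y\<close> into two terms, and bounding the
  powers of \<open>x\<close> and \<open>y\<close> at rate \<open>e / 2\<close> compensates for the doubling.
\<close>

lemma quasinilpotent_add_commuting:
  fixes x y :: "'a::complex_banach_algebra_1"
  assumes x: "quasinilpotent x" and y: "quasinilpotent y" and xy: "x * y = y * x"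
  shows "quasinilpotent (x + y)"
  unfolding quasinilpotent_iff_geometric
proof (intro allI impI)
  fix e :: real
  assume "e > 0"
  then have e: "e / 2 > 0" by simp
  obtain C where C: "C > 0" "\<And>n. norm (x ^ n) \<le> C * (e / 2) ^ n"
    using x e unfolding quasinilpotent_iff_geometric by meson
  obtain D where D: "D > 0" "\<And>n. norm (y ^ n) \<le> D * (e / 2) ^ n"
    using y e unfolding quasinilpotent_iff_geometric by meson
  have bound: "norm ((x + y) ^ n * (x ^ i * y ^ j)) \<le> C * D * e ^ n * (e / 2) ^ (i + j)" for n i j
  proof (induction n arbitrary: i j)
    case 0
    have "norm (x ^ i * y ^ j) \<le> norm (x ^ i) * norm (y ^ j)"
      by (rule norm_mult_ineq)
    also have "\<dots> \<le> (C * (e / 2) ^ i) * (D * (e / 2) ^ j)"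
      using C D e by (intro mult_mono) auto
    finally show ?case
      by (simp add: power_add mult_ac)
  next
    case (Suc n)
    have "y * x ^ i = x ^ i * y"
      using xy by (metis power_commuting_commutes)
    then have "(x + y) * (x ^ i * y ^ j) = x ^ Suc i * y ^ j + x ^ i * y ^ Suc j"
      by (simp add: distrib_right mult.assoc[symmetric])
    then have "(x + y) ^ Suc n * (x ^ i * y ^ j) =
        (x + y) ^ n * (x ^ Suc i * y ^ j) + (x + y) ^ n * (x ^ i * y ^ Suc j)"
      by (metis power_Suc2 mult.assoc distrib_left)
    also have "norm \<dots> \<le> C * D * e ^ n * (e / 2) ^ (Suc i + j) + C * D * e ^ n * (e / 2) ^ (i + Suc j)"
      by (intro norm_triangle_mono Suc.IH)
    also have "\<dots> = C * D * e ^ Suc n * (e / 2) ^ (i + j)"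
      by (simp add: field_simps)
    finally show ?case .
  qed
  have "norm ((x + y) ^ n) \<le> C * D * e ^ n" for n
    using bound[of n 0 0] by simp
  with C(1) D(1) show "\<exists>C>0. \<forall>n. norm ((x + y) ^ n) \<le> C * e ^ n"
    by (meson mult_pos_pos)
qed

text \<open>
  The inverse is the Neumann series of \<open>- t\<close>; being a limit of polynomials in \<open>t\<close>, it commutes with
  whatever commutes with \<open>t\<close>.
\<close>

lemma quasinilpotent_one_add_inverse:
  fixes t :: "'a::complex_banach_algebra_1"
  assumes "quasinilpotent t"
  obtains r where "(1 + t) * r = 1" "r * (1 + t) = 1" "\<And>z. z * t = t * z \<Longrightarrow> z * r = r * z"
proof -
  obtain C where C: "\<And>n. norm (t ^ n) \<le> C * (1 / 2) ^ n"
    using assms unfolding quasinilpotent_iff_geometric by (meson half_gt_zero zero_less_one)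
  have norm_minus_power: "norm ((- t) ^ n) = norm (t ^ n)" for n
    by (cases "even n") auto
  have summ: "summable (\<lambda>n. (- t) ^ n)"
  proof (rule summable_comparison_test)
    show "\<exists>N. \<forall>n\<ge>N. norm ((- t) ^ n) \<le> C * (1 / 2) ^ n"
      using C by (simp add: norm_minus_power)
    show "summable (\<lambda>n. C * (1 / 2) ^ n :: real)"
      by (intro summable_mult summable_geometric) simp
  qed
  define r where "r = (\<Sum>n. (- t) ^ n)"
  have commute: "z * r = r * z" if z: "z * t = t * z" for z
  proof -
    have "z * (- t) ^ n = (- t) ^ n * z" for n
      using z by (metis mult_minus_left mult_minus_right power_commuting_commutes)
    then show ?thesis
      using suminf_mult[OF summ, of z] suminf_mult2[OF summ, of z] by (simp add: r_def)
  qed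
  have "r = 1 + (- t) * r"
    using suminf_split_head[OF summ] suminf_mult[OF summ, of "- t"]
    by (simp add: r_def algebra_simps)
  then have right: "(1 + t) * r = 1"
    by (simp add: distrib_right eq_diff_eq)
  have "(1 + t) * r = r * (1 + t)"
    by (rule commute) (simp add: algebra_simps)
  then show ?thesis
    using that[of r] right commute by simp
qed

section \<open>Elements commuting with a g-Drazin invertible element\<close>

text \<open>
  The g-Drazin inverse lies in the double commutant. The off-diagonal parts of \<open>y\<close> with respect to
  the idempotent \<open>x d\<close> vanish: writing \<open>x d = d\<^sup>n x\<^sup>n\<close> and moving \<open>x\<^sup>n\<close> across \<open>y\<close> exhibits such a part
  as a product of \<open>d\<^sup>n\<close>, \<open>y\<close> and \<open>(x p)\<^sup>n\<close> with \<open>p = 1 - x d\<close>, and this tends to \<open>0\<close> since \<open>x p\<close>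
  is quasinilpotent.
\<close>

lemma gdrazin_inverse_commute:
  fixes x d y :: "'a::complex_banach_algebra_1"
  assumes gd: "is_gdrazin_inverse x d" and xy: "x * y = y * x"
  shows "d * y = y * d"
proof -
  have xd: "x * d = d * x" and dxd: "d * x * d = d"
    and qn: "quasinilpotent (x - x\<^sup>2 * d)"
    using gd by (auto simp: is_gdrazin_inverse_def)
  define p where "p = 1 - x * d"
  have xp: "x * p = p * x"
    by (simp add: p_def algebra_simps) (metis xd mult.assoc)
  have pp: "p * p = p"
    by (simp add: p_def algebra_simps) (metis dxd mult.assoc)
  have xxd: "x - x\<^sup>2 * d = x * p"
    by (simp add: p_def algebra_simps power2_eq_square)
  have p_pow: "p ^ Suc n = p" for n
    by (induction n) (simp_all add: pp)
  have xp_pow: "(x * p) ^ Suc n = x ^ Suc n * p" for n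
    by (simp only: power_mult_commuting[OF xp] p_pow)
  have xd_pow: "(x * d) ^ Suc n = x * d" for n
    by (induction n) (simp_all, metis dxd mult.assoc)
  have xdn: "x ^ Suc n * d ^ Suc n = x * d" "d ^ Suc n * x ^ Suc n = x * d" for n
    using power_mult_commuting[OF xd, of "Suc n"] power_mult_commuting[OF xd[symmetric], of "Suc n"]
      xd_pow[of n] xd by simp_all
  have xny: "x ^ n * y = y * x ^ n" and xnp: "x ^ n * p = p * x ^ n" for n
    using xy xp by (simp_all add: power_commuting_commutes)
  define B where "B n = norm d ^ Suc n * norm ((x * p) ^ Suc n) * norm y" for n
  have "(\<lambda>n. norm d ^ Suc n * norm ((x * p) ^ Suc n)) \<longlonglongrightarrow> 0"
    using LIMSEQ_Suc[OF quasinilpotent_power_tendsto[OF qn, of "norm d"]] by (simp add: xxd)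
  then have lim: "B \<longlonglongrightarrow> 0"
    unfolding B_def by (rule tendsto_mult_left_zero)
  have le1: "norm (x * d * y * p) \<le> B n" for n
  proof -
    have "x * d * y * p = d ^ Suc n * (x ^ Suc n * y) * p"
      by (simp only: xdn(2)[of n, symmetric] mult.assoc)
    also have "\<dots> = d ^ Suc n * (y * (x * p) ^ Suc n)"
      by (simp only: xny xp_pow mult.assoc)
    also have "norm \<dots> \<le> norm (d ^ Suc n) * (norm y * norm ((x * p) ^ Suc n))"
      by (intro order_trans[OF norm_mult_ineq] mult_left_mono norm_mult_ineq) auto
    also have "\<dots> \<le> norm d ^ Suc n * (norm y * norm ((x * p) ^ Suc n))"
      by (intro mult_right_mono norm_power_ineq) auto
    finally show ?thesis by (simp only: B_def mult_ac)
  qed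
  have le2: "norm (p * y * (x * d)) \<le> B n" for n
  proof -
    have "p * y * (x * d) = p * (y * x ^ Suc n) * d ^ Suc n"
      by (simp only: xdn(1)[of n, symmetric] mult.assoc)
    also have "\<dots> = p * x ^ Suc n * y * d ^ Suc n"
      by (simp only: xny[symmetric] mult.assoc)
    also have "\<dots> = ((x * p) ^ Suc n * y) * d ^ Suc n"
      by (simp only: xnp xp_pow)
    also have "norm \<dots> \<le> norm ((x * p) ^ Suc n) * norm y * norm (d ^ Suc n)"
      by (intro order_trans[OF norm_mult_ineq] mult_right_mono norm_mult_ineq) auto
    also have "\<dots> \<le> norm ((x * p) ^ Suc n) * norm y * norm d ^ Suc n"
      by (intro mult_left_mono norm_power_ineq) auto
    finally show ?thesis by (simp only: B_def mult_ac)
  qed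
  have "norm (x * d * y * p) \<le> 0"
    by (rule LIMSEQ_le_const[OF lim]) (use le1 in blast)
  moreover have "norm (p * y * (x * d)) \<le> 0"
    by (rule LIMSEQ_le_const[OF lim]) (use le2 in blast)
  ultimately have "x * d * y = x * d * y * (x * d)" "y * (x * d) = x * d * y * (x * d)"
    by (simp_all add: p_def left_diff_distrib right_diff_distrib)
  then have idem: "x * d * y = y * (x * d)" by simp
  have "d * y = d * (x * d * y)"
    using dxd by (simp add: mult.assoc[symmetric])
  also have "\<dots> = d * y * x * d"
    by (metis idem mult.assoc)
  also have "\<dots> = (x * d * y) * d"
    by (metis xd xy mult.assoc)
  also have "\<dots> = y * (d * x * d)"
    by (metis idem xd mult.assoc)
  finally show ?thesis by (simp add: dxd)
qed

lemma is_gdrazin_inverse_square: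
  fixes x d :: "'a::complex_banach_algebra_1"
  assumes gd: "is_gdrazin_inverse x d"
  shows "is_gdrazin_inverse (x\<^sup>2) (d\<^sup>2)"
proof -
  have xd: "x * d = d * x" and dxd: "d * x * d = d"
    and qn: "quasinilpotent (x - x\<^sup>2 * d)"
    using gd by (auto simp: is_gdrazin_inverse_def)
  have "(x - x\<^sup>2 * d)\<^sup>2 = x\<^sup>2 - (x\<^sup>2)\<^sup>2 * d\<^sup>2"
  proof -
    define e where "e = x * d"
    have ex: "e * x = x * e" and ee: "e * e = e"
      by (simp_all add: e_def) (metis xd dxd mult.assoc)+
    have ee': "e * (e * z) = e * z" and ex': "e * (x * z) = x * (e * z)" for z
      by (metis ee mult.assoc, metis ex mult.assoc)
    have "x\<^sup>2 * d = x * e" "(x\<^sup>2)\<^sup>2 * d\<^sup>2 = x * x * e"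
      unfolding e_def power2_eq_square by (metis mult.assoc, metis xd dxd mult.assoc)
    then show ?thesis
      by (simp add: power2_eq_square algebra_simps ex ee ex' ee')
  qed
  then have "quasinilpotent (x\<^sup>2 - (x\<^sup>2)\<^sup>2 * d\<^sup>2)"
    using qn by (metis quasinilpotent_square_iff)
  moreover have "x\<^sup>2 * d\<^sup>2 = d\<^sup>2 * x\<^sup>2" "d\<^sup>2 * x\<^sup>2 * d\<^sup>2 = d\<^sup>2"
    unfolding power2_eq_square by (metis xd mult.assoc, metis xd dxd mult.assoc)
  ultimately show ?thesis
    by (simp add: is_gdrazin_inverse_def)
qed

lemma gdrazin_projection_idem:
  fixes x d :: "'a::complex_banach_algebra_1"
  assumes "is_gdrazin_inverse x d"
  shows "x * d * (x * d) = x * d"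
  using assms unfolding is_gdrazin_inverse_def by (metis mult.assoc)

text \<open>
  An element commuting with \<open>x\<^sup>2\<close> commutes with the g-Drazin inverse \<open>d\<^sup>2\<close> of \<open>x\<^sup>2\<close> and hence with
  \<open>x d = x\<^sup>2 d\<^sup>2\<close>, but in general not with \<open>d\<close> itself.
\<close>

lemma gdrazin_commute_of_square_commute:
  fixes x d y :: "'a::complex_banach_algebra_1"
  assumes gd: "is_gdrazin_inverse x d" and comm: "x\<^sup>2 * y = y * x\<^sup>2"
  shows "d\<^sup>2 * y = y * d\<^sup>2" "x * d * y = y * (x * d)"
proof -
  show d2: "d\<^sup>2 * y = y * d\<^sup>2"
    using gdrazin_inverse_commute[OF is_gdrazin_inverse_square[OF gd] comm] .
  have xd: "x * d = d * x" and dxd: "d * x * d = d"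
    using gd by (auto simp: is_gdrazin_inverse_def)
  have "x * d = x\<^sup>2 * d\<^sup>2"
    unfolding power2_eq_square by (metis xd dxd mult.assoc)
  then show "x * d * y = y * (x * d)"
    by (metis comm d2 mult.assoc)
qed

section \<open>Splitting along a commuting idempotent\<close>

lemma gdrazin_invertible_idem_mult:
  fixes x e :: "'a::complex_banach_algebra_1"
  assumes "gdrazin_invertible x" and ee: "e * e = e" and ex: "e * x = x * e"
  shows "gdrazin_invertible (e * x)"
proof -
  obtain d where gd: "is_gdrazin_inverse x d"
    using assms by (auto simp: gdrazin_invertible_def)
  have xd: "x * d = d * x" and dxd: "d * x * d = d"
    and qn: "quasinilpotent (x - x\<^sup>2 * d)"
    using gd by (auto simp: is_gdrazin_inverse_def)
  have ed: "e * d = d * e"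
    using gdrazin_inverse_commute[OF gd ex[symmetric]] by simp
  have c1: "e * x * (e * d) = e * d * (e * x)"
    by (metis xd ed ex ee mult.assoc)
  have c2: "e * d * (e * x) * (e * d) = e * d"
    by (metis dxd ed ex ee mult.assoc)
  have "(e * x)\<^sup>2 * (e * d) = x\<^sup>2 * d * e"
    unfolding power2_eq_square by (metis ed ex ee mult.assoc)
  then have eq: "e * x - (e * x)\<^sup>2 * (e * d) = (x - x\<^sup>2 * d) * e"
    by (simp add: left_diff_distrib ex)
  have "(x - x\<^sup>2 * d) * e = e * (x - x\<^sup>2 * d)"
    unfolding power2_eq_square left_diff_distrib right_diff_distrib by (metis ed ex mult.assoc)
  then have "quasinilpotent (e * x - (e * x)\<^sup>2 * (e * d))"
    unfolding eq by (rule quasinilpotent_mult_commuting[OF qn])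
  with c1 c2 show ?thesis
    unfolding gdrazin_invertible_def is_gdrazin_inverse_def by blast
qed

text \<open>
  Orthogonal elements have orthogonal g-Drazin inverses, because \<open>c = u c c = c c u\<close>; so the
  inverses simply add up.
\<close>

lemma gdrazin_invertible_orthogonal_add:
  fixes u v :: "'a::complex_banach_algebra_1"
  assumes "gdrazin_invertible u" "gdrazin_invertible v"
    and uv: "u * v = 0" and vu: "v * u = 0"
  shows "gdrazin_invertible (u + v)"
proof -
  obtain c d where c: "is_gdrazin_inverse u c" and d: "is_gdrazin_inverse v d"
    using assms by (auto simp: gdrazin_invertible_def)
  have uc: "u * c = c * u" and cuc: "c * u * c = c"
    and qu: "quasinilpotent (u - u\<^sup>2 * c)"
    using c by (auto simp: is_gdrazin_inverse_def)
  have vd: "v * d = d * v" and dvd: "d * v * d = d"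
    and qv: "quasinilpotent (v - v\<^sup>2 * d)"
    using d by (auto simp: is_gdrazin_inverse_def)
  have ccu: "c = c * c * u" "c = u * c * c" and ddv: "d = d * d * v" "d = v * d * d"
    by (metis uc cuc mult.assoc, metis uc cuc mult.assoc,
        metis vd dvd mult.assoc, metis vd dvd mult.assoc)
  have cv: "c * v = 0" and vc: "v * c = 0"
    by (metis ccu(1) uv mult.assoc mult_zero_right, metis ccu(2) vu mult.assoc mult_zero_left)
  have du: "d * u = 0" and ud: "u * d = 0"
    by (metis ddv(1) vu mult.assoc mult_zero_right, metis ddv(2) uv mult.assoc mult_zero_left)
  have cd: "c * d = 0" and dc: "d * c = 0"
    by (metis ccu(1) ud mult.assoc mult_zero_right, metis ddv(1) vc mult.assoc mult_zero_right)
  note zero = uv vu cv vc du ud cd dc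
  have zero': "u * (v * z) = 0" "v * (u * z) = 0" "c * (v * z) = 0" "v * (c * z) = 0"
    "d * (u * z) = 0" "u * (d * z) = 0" "c * (d * z) = 0" "d * (c * z) = 0" for z
    using zero by (simp_all add: mult.assoc[symmetric])
  have "(u + v) * (c + d) = (c + d) * (u + v)"
    by (simp add: distrib_left distrib_right zero uc vd)
  moreover have "(c + d) * (u + v) * (c + d) = c + d"
    using cuc dvd by (simp add: distrib_left distrib_right mult.assoc zero zero')
  moreover have "quasinilpotent (u + v - (u + v)\<^sup>2 * (c + d))"
  proof -
    have "(u + v)\<^sup>2 * (c + d) = u\<^sup>2 * c + v\<^sup>2 * d"
      by (simp add: power2_eq_square distrib_left distrib_right mult.assoc zero zero')
    then have "u + v - (u + v)\<^sup>2 * (c + d) = (u - u\<^sup>2 * c) + (v - v\<^sup>2 * d)"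
      by simp
    moreover have "(u - u\<^sup>2 * c) * (v - v\<^sup>2 * d) = (v - v\<^sup>2 * d) * (u - u\<^sup>2 * c)"
      by (simp add: power2_eq_square left_diff_distrib right_diff_distrib mult.assoc zero zero')
    ultimately show ?thesis
      using quasinilpotent_add_commuting[OF qu qv] by (simp only:)
  qed
  ultimately show ?thesis
    unfolding gdrazin_invertible_def is_gdrazin_inverse_def by blast
qed

lemma gdrazin_invertible_split_iff:
  fixes x e :: "'a::complex_banach_algebra_1"
  assumes ee: "e * e = e" and ex: "e * x = x * e"
  shows "gdrazin_invertible x \<longleftrightarrow>
    gdrazin_invertible (e * x) \<and> gdrazin_invertible ((1 - e) * x)"
proof
  have ff: "(1 - e) * (1 - e) = 1 - e" and fx: "(1 - e) * x = x * (1 - e)"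
    using ee ex by (simp_all add: algebra_simps)
  assume "gdrazin_invertible x"
  then show "gdrazin_invertible (e * x) \<and> gdrazin_invertible ((1 - e) * x)"
    using gdrazin_invertible_idem_mult[OF _ ee ex] gdrazin_invertible_idem_mult[OF _ ff fx] by blast
next
  have "e * x * ((1 - e) * x) = 0" "(1 - e) * x * (e * x) = 0"
    by (simp_all add: algebra_simps) (metis ee ex mult.assoc)+
  moreover assume "gdrazin_invertible (e * x) \<and> gdrazin_invertible ((1 - e) * x)"
  ultimately have "gdrazin_invertible (e * x + (1 - e) * x)"
    by (intro gdrazin_invertible_orthogonal_add) auto
  then show "gdrazin_invertible x"
    by (simp add: algebra_simps)
qed

section \<open>Weakly commutative pairs\<close>

lemma weakly_commutative_sym: "weakly_commutative a b \<Longrightarrow> weakly_commutative b a"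
  unfolding weakly_commutative_def left_weakly_commutative_def right_weakly_commutative_def
  by blast

lemma weakly_commutative_square_commute:
  fixes a b :: "'a::complex_banach_algebra_1"
  assumes "weakly_commutative a b"
  shows "a\<^sup>2 * b = b * a\<^sup>2"
  using assms unfolding weakly_commutative_def left_weakly_commutative_def power2_eq_square
  by (metis mult.assoc)

text \<open>
  The witness \<open>c\<close> need not commute with \<open>e\<close>, so it has to be compressed to \<open>e c e\<close>.
\<close>

lemma weakly_commutative_idem_mult:
  fixes a b e :: "'a::complex_banach_algebra_1"
  assumes wc: "weakly_commutative a b"
    and ee: "e * e = e" and ea: "e * a = a * e" and eb: "e * b = b * e"
  shows "weakly_commutative (e * a) (e * b)"
proof -
  have left: "left_weakly_commutative (e * x) (e * y)"
    if lw: "left_weakly_commutative x y" and ex: "e * x = x * e" and ey: "e * y = y * e" for x y :: 'a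
  proof -
    obtain c where c: "x * y = c * x" "y * x = x * c"
      using lw by (auto simp: left_weakly_commutative_def)
    have "e * x * (e * y) = e * (x * y) * e" "e * y * (e * x) = e * (y * x) * e"
      by (metis ee ex ey mult.assoc)+
    moreover have "e * (c * x) * e = e * c * e * (e * x)" "e * (x * c) * e = e * x * (e * c * e)"
      by (metis ee ex mult.assoc)+
    ultimately show ?thesis
      unfolding left_weakly_commutative_def by (metis c)
  qed
  have right_iff: "right_weakly_commutative x y \<longleftrightarrow> left_weakly_commutative y x" for x y :: 'a
    unfolding left_weakly_commutative_def right_weakly_commutative_def by blast
  show ?thesis
    using wc left ea eb unfolding weakly_commutative_def right_iff by blast
qed

text \<open>
  In \<open>(a + b)\<^sup>2 = (a\<^sup>2 + b\<^sup>2) + w\<close> with \<open>w = a b + b a\<close>, the first summand commutes with \<open>a\<close> and \<open>b\<close>,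
  hence with \<open>w\<close>. Each of the four words in \<open>w\<^sup>2\<close> has a factor \<open>a\<^sup>2\<close>; for instance
  \<open>a b a b = a (a c) b = a\<^sup>2 c b\<close>. So \<open>w\<^sup>2\<close> is a commuting multiple of the quasinilpotent \<open>a\<^sup>2\<close>.
\<close>

lemma quasinilpotent_add_weakly_commutative:
  fixes a b :: "'a::complex_banach_algebra_1"
  assumes qa: "quasinilpotent a" and qb: "quasinilpotent b" and wc: "weakly_commutative a b"
  shows "quasinilpotent (a + b)"
proof -
  obtain c where c: "a * b = c * a" "b * a = a * c"
    using wc by (auto simp: weakly_commutative_def left_weakly_commutative_def)
  have a2b: "a\<^sup>2 * b = b * a\<^sup>2" and b2a: "b\<^sup>2 * a = a * b\<^sup>2"
    using wc by (simp_all add: weakly_commutative_square_commute weakly_commutative_sym)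
  have a2c: "a\<^sup>2 * c = c * a\<^sup>2"
    unfolding power2_eq_square by (metis c mult.assoc)
  have qa2: "quasinilpotent (a\<^sup>2)" and qb2: "quasinilpotent (b\<^sup>2)"
    using qa qb by (simp_all add: quasinilpotent_square_iff)
  define w where "w = a * b + b * a"
  have w2: "w\<^sup>2 = a\<^sup>2 * (c * b + b * c + 2 * b\<^sup>2)"
  proof -
    have "a * b * (a * b) = a\<^sup>2 * (c * b)"
      unfolding power2_eq_square by (metis c mult.assoc)
    moreover have "b * a * (b * a) = a\<^sup>2 * (b * c)"
      using a2b unfolding power2_eq_square by (metis c mult.assoc)
    moreover have "a * b * (b * a) = a\<^sup>2 * b\<^sup>2"
      using b2a unfolding power2_eq_square by (metis mult.assoc)
    moreover have "b * a * (a * b) = a\<^sup>2 * b\<^sup>2"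
      using a2b unfolding power2_eq_square by (metis mult.assoc)
    ultimately show ?thesis
      unfolding w_def power2_eq_square[of "_ + _"]
      by (simp add: distrib_left distrib_right mult_2)
  qed
  have "a\<^sup>2 * (c * b + b * c + 2 * b\<^sup>2) = (c * b + b * c + 2 * b\<^sup>2) * a\<^sup>2"
  proof -
    have "a\<^sup>2 * (c * b) = c * b * a\<^sup>2" "a\<^sup>2 * (b * c) = b * c * a\<^sup>2" "a\<^sup>2 * b\<^sup>2 = b\<^sup>2 * a\<^sup>2"
      using a2b a2c by (metis mult.assoc power2_eq_square)+
    then show ?thesis
      by (simp add: distrib_left distrib_right mult_2)
  qed
  then have "quasinilpotent (w\<^sup>2)"
    unfolding w2 by (rule quasinilpotent_mult_commuting[OF qa2])
  then have qw: "quasinilpotent w"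
    by (simp add: quasinilpotent_square_iff)
  have qz: "quasinilpotent (a\<^sup>2 + b\<^sup>2)"
    by (rule quasinilpotent_add_commuting[OF qa2 qb2]) (metis a2b mult.assoc power2_eq_square)
  have zc: "(a\<^sup>2 + b\<^sup>2) * a = a * (a\<^sup>2 + b\<^sup>2)" "(a\<^sup>2 + b\<^sup>2) * b = b * (a\<^sup>2 + b\<^sup>2)"
    using a2b b2a by (simp_all add: distrib_left distrib_right power2_eq_square mult.assoc)
  have "(a\<^sup>2 + b\<^sup>2) * w = w * (a\<^sup>2 + b\<^sup>2)"
    unfolding w_def distrib_left[of _ "a * b"] distrib_right[of "a * b"]
    by (simp only: commute_mult zc)
  then have "quasinilpotent (a\<^sup>2 + b\<^sup>2 + w)"
    by (rule quasinilpotent_add_commuting[OF qz qw])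
  moreover have "(a + b)\<^sup>2 = a\<^sup>2 + b\<^sup>2 + w"
    by (simp add: w_def power2_eq_square algebra_simps)
  ultimately show ?thesis
    using quasinilpotent_square_iff by metis
qed

text \<open>
  Substituting \<open>d = d\<^sup>2 b\<close> for the second \<open>d\<close> in \<open>d a d a\<close> and moving \<open>d\<^sup>2\<close>, which commutes with \<open>a\<close>,
  to the left gives \<open>d\<^sup>3 a b a = d\<^sup>3 a\<^sup>2 c\<close>. Here \<open>a\<^sup>2\<close> commutes with \<open>d\<close> and \<open>c\<close>.
\<close>

lemma quasinilpotent_gdrazin_inverse_mult:
  fixes a b d :: "'a::complex_banach_algebra_1"
  assumes qa: "quasinilpotent a" and gd: "is_gdrazin_inverse b d" and wc: "weakly_commutative a b"
  shows "quasinilpotent (d * a)"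
proof -
  obtain c where c: "a * b = c * a" "b * a = a * c"
    using wc by (auto simp: weakly_commutative_def left_weakly_commutative_def)
  have bd: "b * d = d * b" and dbd: "d * b * d = d"
    using gd by (auto simp: is_gdrazin_inverse_def)
  have a2b: "a\<^sup>2 * b = b * a\<^sup>2" and b2a: "b\<^sup>2 * a = a * b\<^sup>2"
    using wc by (simp_all add: weakly_commutative_square_commute weakly_commutative_sym)
  have a2c: "a\<^sup>2 * c = c * a\<^sup>2"
    unfolding power2_eq_square by (metis c mult.assoc)
  have d2a: "d\<^sup>2 * a = a * d\<^sup>2"
    by (rule gdrazin_commute_of_square_commute(1)[OF gd b2a])
  have a2d: "a\<^sup>2 * d = d * a\<^sup>2"
    using gdrazin_inverse_commute[OF gd a2b[symmetric]] by simp
  have a2d3: "a\<^sup>2 * (d * d\<^sup>2) = d * d\<^sup>2 * a\<^sup>2"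
    unfolding power2_eq_square[of d] by (intro commute_mult a2d)
  have d: "d = d\<^sup>2 * b"
    unfolding power2_eq_square by (metis bd dbd mult.assoc)
  have "(d * a)\<^sup>2 = d * (a * d\<^sup>2) * (b * a)"
    unfolding power2_eq_square[of "d * a"] by (metis d mult.assoc)
  also have "\<dots> = d * d\<^sup>2 * a * (a * c)"
    by (simp only: d2a[symmetric] c(2) mult.assoc)
  also have "\<dots> = d * d\<^sup>2 * (a\<^sup>2 * c)"
    by (simp add: power2_eq_square mult.assoc)
  also have "\<dots> = a\<^sup>2 * (d * d\<^sup>2) * c"
    by (simp only: a2d3) (simp only: mult.assoc)
  also have "\<dots> = a\<^sup>2 * (d * d\<^sup>2 * c)"
    by (simp only: mult.assoc)
  finally have sq: "(d * a)\<^sup>2 = a\<^sup>2 * (d * d\<^sup>2 * c)" .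
  have "a\<^sup>2 * (d * d\<^sup>2 * c) = d * d\<^sup>2 * c * a\<^sup>2"
    by (rule commute_mult[OF a2d3 a2c])
  then have "quasinilpotent ((d * a)\<^sup>2)"
    unfolding sq using qa by (intro quasinilpotent_mult_commuting) (simp_all add: quasinilpotent_square_iff)
  then show ?thesis
    by (simp add: quasinilpotent_square_iff)
qed

lemma gdrazin_invertible_quasinilpotent:
  fixes x :: "'a::complex_banach_algebra_1"
  assumes "quasinilpotent x"
  shows "gdrazin_invertible x"
  unfolding gdrazin_invertible_def is_gdrazin_inverse_def
  using assms by (intro exI[of _ 0]) simp

lemma gdrazin_invertible_quasinilpotent_add:
  fixes a b :: "'a::complex_banach_algebra_1"
  assumes qa: "quasinilpotent a" and "gdrazin_invertible b" and wc: "weakly_commutative a b"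
  shows "gdrazin_invertible (a + b)"
proof -
  obtain d where gd: "is_gdrazin_inverse b d"
    using assms by (auto simp: gdrazin_invertible_def)
  have bd: "b * d = d * b" and dbd: "d * b * d = d" and qn: "quasinilpotent (b - b\<^sup>2 * d)"
    using gd by (auto simp: is_gdrazin_inverse_def)
  define q where "q = b * d"
  have qq: "q * q = q"
    unfolding q_def by (rule gdrazin_projection_idem[OF gd])
  have qa_comm: "q * a = a * q"
    unfolding q_def
    by (rule gdrazin_commute_of_square_commute(2)[OF gd
          weakly_commutative_square_commute[OF weakly_commutative_sym[OF wc]]])
  have qb: "q * b = b * q" and qd: "q * d = d" "d * q = d"
    unfolding q_def by (metis bd dbd mult.assoc)+
  \<comment> \<open>Under \<open>1 - q\<close> the sum is quasinilpotent.\<close>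
  define f where "f = 1 - q"
  have ff: "f * f = f" and fa: "f * a = a * f" and fb: "f * b = b * f"
    using qq qa_comm qb by (simp_all add: f_def algebra_simps)
  have "quasinilpotent (f * a + f * b)"
  proof (rule quasinilpotent_add_weakly_commutative)
    show "quasinilpotent (f * a)"
      using quasinilpotent_mult_commuting[OF qa fa[symmetric]] by (simp add: fa)
    have "f * b = b - b\<^sup>2 * d"
      by (simp add: fb) (simp add: f_def q_def algebra_simps power2_eq_square)
    then show "quasinilpotent (f * b)"
      using qn by simp
    show "weakly_commutative (f * a) (f * b)"
      by (rule weakly_commutative_idem_mult[OF wc ff fa fb])
  qed
  then have nil_part: "gdrazin_invertible ((1 - q) * (a + b))"
    by (simp add: gdrazin_invertible_quasinilpotent f_def distrib_left)
  \<comment> \<open>Under \<open>q\<close> the sum is \<open>b (1 + t)\<close>, whose inverse relative to the unit \<open>q\<close> is \<open>r d\<close>, where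
    \<open>r = (1 + t)\<^sup>-\<^sup>1\<close>; it stays in the corner because \<open>q\<close> commutes with \<open>r\<close>.\<close>
  define t where "t = d * a"
  obtain r where r: "(1 + t) * r = 1" "r * (1 + t) = 1" "\<And>z. z * t = t * z \<Longrightarrow> z * r = r * z"
    using quasinilpotent_one_add_inverse[OF quasinilpotent_gdrazin_inverse_mult[OF qa gd wc]]
    unfolding t_def by blast
  have qt: "q * t = t * q"
    unfolding t_def by (metis qd qa_comm mult.assoc)
  have qr: "q * r = r * q"
    by (rule r(3)[OF qt])
  define s where "s = q * (a + b)"
  have s: "s = b * q * (1 + t)"
  proof -
    have "b * q * t = q * a"
      unfolding t_def by (metis qd(1) q_def mult.assoc)
    then show ?thesis
      by (simp add: s_def distrib_left qb add.commute)
  qed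
  have "s * (r * d) = b * q * ((1 + t) * r) * d"
    by (simp add: s mult.assoc)
  also have "\<dots> = q"
    by (simp add: r mult.assoc qd) (simp add: q_def)
  finally have sy: "s * (r * d) = q" .
  have "r * d * s = r * (d * b) * q * (1 + t)"
    by (simp add: s mult.assoc)
  also have "\<dots> = q * (r * (1 + t))"
    by (metis bd q_def qq qr mult.assoc)
  finally have ys: "r * d * s = q"
    by (simp add: r)
  have "q * (r * d) = r * d"
    by (metis qr qd(1) mult.assoc)
  moreover have "s\<^sup>2 * (r * d) = s"
    unfolding power2_eq_square mult.assoc[of s s] sy
    by (metis s_def qq qa_comm qb distrib_left distrib_right mult.assoc)
  ultimately have "is_gdrazin_inverse s (r * d)"
    using sy ys unfolding is_gdrazin_inverse_def by (simp add: quasinilpotent_zero)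
  then have inv_part: "gdrazin_invertible (q * (a + b))"
    unfolding gdrazin_invertible_def s_def by blast
  have "q * (a + b) = (a + b) * q"
    using qa_comm qb by (simp add: distrib_left distrib_right)
  then show ?thesis
    using gdrazin_invertible_split_iff[OF qq] inv_part nil_part by blast
qed

lemma gdrazin_invertible_complement_add:
  fixes a b d :: "'a::complex_banach_algebra_1"
  assumes gd: "is_gdrazin_inverse a d" and gb: "gdrazin_invertible b"
    and wc: "weakly_commutative a b"
  shows "gdrazin_invertible ((1 - a * d) * (a + b))"
proof -
  have ad: "a * d = d * a" and dad: "d * a * d = d" and qn: "quasinilpotent (a - a\<^sup>2 * d)"
    using gd by (auto simp: is_gdrazin_inverse_def)
  define f where "f = 1 - a * d"
  have pb: "a * d * b = b * (a * d)"
    by (rule gdrazin_commute_of_square_commute(2)[OF gd weakly_commutative_square_commute[OF wc]])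
  have ff: "f * f = f"
    using gdrazin_projection_idem[OF gd] by (simp add: f_def algebra_simps)
  have fa: "f * a = a * f"
    by (simp add: f_def algebra_simps) (metis ad mult.assoc)
  have fb: "f * b = b * f"
    using pb by (simp add: f_def algebra_simps)
  have "f * a = a - a\<^sup>2 * d"
    by (simp add: fa) (simp add: f_def algebra_simps power2_eq_square)
  with qn have "quasinilpotent (f * a)" by simp
  then have "gdrazin_invertible (f * a + f * b)"
    using gdrazin_invertible_idem_mult[OF gb ff fb] weakly_commutative_idem_mult[OF wc ff fa fb]
    by (rule gdrazin_invertible_quasinilpotent_add)
  then show ?thesis
    by (simp add: f_def distrib_left)
qed

section \<open>The additive characterisation\<close>

theorem theorem5p8:
  fixes a b :: "'a::complex_banach_algebra_1"
  assumes "gdrazin_invertible a" and "gdrazin_invertible b"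
    and "weakly_commutative a b"
  shows "(gdrazin_invertible (a + b) \<longleftrightarrow>
            gdrazin_invertible (a * gdrazin_inverse a * (a + b) * b * gdrazin_inverse b))
       \<and> (gdrazin_invertible (a + b) \<longleftrightarrow>
            gdrazin_invertible (a * gdrazin_inverse a * (a + b)))
       \<and> (gdrazin_invertible (a + b) \<longleftrightarrow>
            gdrazin_invertible ((a + b) * b * gdrazin_inverse b))"
proof -
  note wc = assms(3)
  have gda: "is_gdrazin_inverse a (gdrazin_inverse a)" and gdb: "is_gdrazin_inverse b (gdrazin_inverse b)"
    using assms(1,2) by (simp_all only: is_gdrazin_inverse_gdrazin_inverse)
  define p where "p = a * gdrazin_inverse a"
  define q where "q = b * gdrazin_inverse b"
  define s where "s = a + b"
  have pp: "p * p = p" and qq: "q * q = q"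
    unfolding p_def q_def by (rule gdrazin_projection_idem[OF gda], rule gdrazin_projection_idem[OF gdb])
  have pa: "p * a = a * p" and qb: "q * b = b * q"
    using gda gdb unfolding p_def q_def is_gdrazin_inverse_def by (metis mult.assoc)+
  have pb: "p * b = b * p" and qa: "q * a = a * q"
    unfolding p_def q_def
    using weakly_commutative_square_commute[OF wc]
      weakly_commutative_square_commute[OF weakly_commutative_sym[OF wc]]
    by (simp_all only: gdrazin_commute_of_square_commute(2)[OF gda]
        gdrazin_commute_of_square_commute(2)[OF gdb])
  have ps: "p * s = s * p" and qs: "q * s = s * q"
    using pa pb qa qb by (simp_all add: s_def distrib_left distrib_right)
  have "a\<^sup>2 * q = q * a\<^sup>2"
    unfolding power2_eq_square by (metis qa mult.assoc)
  then have pq: "p * q = q * p"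
    unfolding p_def by (rule gdrazin_commute_of_square_commute(2)[OF gda])
  have compl_p: "gdrazin_invertible ((1 - p) * s)"
    unfolding p_def s_def by (rule gdrazin_invertible_complement_add[OF gda assms(2) wc])
  have compl_q: "gdrazin_invertible ((1 - q) * s)"
    unfolding q_def s_def
    using gdrazin_invertible_complement_add[OF gdb assms(1) weakly_commutative_sym[OF wc]]
    by (simp add: add.commute)
  have split_p: "gdrazin_invertible s \<longleftrightarrow> gdrazin_invertible (p * s)"
    using gdrazin_invertible_split_iff[OF pp ps] compl_p by simp
  have split_q: "gdrazin_invertible s \<longleftrightarrow> gdrazin_invertible (q * s)"
    using gdrazin_invertible_split_iff[OF qq qs] compl_q by simp
  \<comment> \<open>Passing from \<open>p s\<close> to \<open>p s q\<close> drops the part \<open>(1 - q) p s\<close>, a compression of \<open>(1 - q) s\<close>.\<close>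
  have "gdrazin_invertible (p * ((1 - q) * s))"
    using compl_q pp
  proof (rule gdrazin_invertible_idem_mult)
    have "p * (1 - q) = (1 - q) * p"
      using pq by (simp add: left_diff_distrib right_diff_distrib)
    then show "p * ((1 - q) * s) = (1 - q) * s * p"
      by (metis ps mult.assoc)
  qed
  then have compl_pq: "gdrazin_invertible ((1 - q) * (p * s))"
    using pq by (simp add: left_diff_distrib right_diff_distrib mult.assoc[symmetric])
  have "q * (p * s) = p * s * q"
    by (metis pq qs mult.assoc)
  then have "gdrazin_invertible (p * s) \<longleftrightarrow> gdrazin_invertible (p * s * q)"
    using gdrazin_invertible_split_iff[OF qq] compl_pq by metis
  then show ?thesis
    using split_p split_q qs unfolding p_def q_def s_def by (simp add: mult.assoc)
qed

end
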